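(* Let $p\in[n]^n$ be a parking preference. Then $p$ is a Motzkin parking function if and only if $\Phi(p)$ is a Motzkin path.
   Context: $[n]=\{1,\dots,n\}$. A parking function of length $n$ is $p\in[n]^n$ whose non-decreasing rearrangement $a_1\le\dots\le a_n$ satisfies $a_i\le i$ for all $i$ (equivalently, all cars manage to park in the classical or MVP parking process where car $i$ prefers spot $p_i$). A Motzkin parking function is a parking function in which, for every $j\in[n]$, $|\{i:p_i=j\}|\le 2$. For $p\in[n]^n$, $\Phi(p)=\phi_1\cdots\phi_n$ is the lattice path with steps $\phi_j=U=(1,1)$ if $|\{i:p_i=j\}|\ge2$, $\phi_j=H=(1,0)$ if $|\{i:p_i=j\}|=1$, and $\phi_j=D=(1,-1)$ if $|\{i:p_i=j\}|=0$. A Motzkin path of length $n$ is a lattice path from $(0,0)$ to $(n,0)$ with steps $U,H,D$ that never goes below the $x$-axis. *)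

theory Defs
  imports Main "HOL-Library.Product_Plus"
begin

text \<open>A preference \<open>p = (p\<^sub>1, \<dots>, p\<^sub>n)\<close> is a list; \<open>p\<^sub>i\<close> is \<open>p ! (i - 1)\<close>, as list positions start at 0.\<close>

definition parking_preferences :: "nat \<Rightarrow> nat list set" where
  "parking_preferences n = {p. length p = n \<and> set p \<subseteq> {1..n}}"

definition multiplicity_of :: "nat list \<Rightarrow> nat \<Rightarrow> nat" where
  "multiplicity_of p j = card {i \<in> {1..length p}. p ! (i - 1) = j}"

definition parking_function :: "nat \<Rightarrow> nat list \<Rightarrow> bool" where
  "parking_function n p \<longleftrightarrow>
     p \<in> parking_preferences n \<and> (\<forall>i\<in>{1..n}. sort p ! (i - 1) \<le> i)"

definition motzkin_parking_function :: "nat \<Rightarrow> nat list \<Rightarrow> bool" where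
  "motzkin_parking_function n p \<longleftrightarrow>
     parking_function n p \<and> (\<forall>j\<in>{1..n}. multiplicity_of p j \<le> 2)"

datatype step = U | H | D

fun step_vector :: "step \<Rightarrow> int \<times> int" where
  "step_vector U = (1, 1)"
| "step_vector H = (1, 0)"
| "step_vector D = (1, -1)"

text \<open>The point reached from the origin after the first \<open>k\<close> steps of a lattice path.\<close>

definition path_point :: "step list \<Rightarrow> nat \<Rightarrow> int \<times> int" where
  "path_point w k = sum_list (map step_vector (take k w))"

text \<open>Paths start at the origin by construction. Since steps are straight segments, a path stays
  weakly above the x-axis iff all its lattice points do.\<close>

definition motzkin_path :: "nat \<Rightarrow> step list \<Rightarrow> bool" where
  "motzkin_path n w \<longleftrightarrow>
     path_point w (length w) = (int n, 0) \<and> (\<forall>k\<le>length w. 0 \<le> snd (path_point w k))"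

definition Phi_step :: "nat list \<Rightarrow> nat \<Rightarrow> step" where
  "Phi_step p j =
     (if multiplicity_of p j \<ge> 2 then U else if multiplicity_of p j = 1 then H else D)"

definition Phi :: "nat \<Rightarrow> nat list \<Rightarrow> step list" where
  "Phi n p = map (Phi_step p) [1..<Suc n]"

end

theory Submission
  imports Defs
begin

text \<open>
  Let \<open>m\<^sub>j\<close> be the number of cars preferring spot \<open>j\<close>. The height of \<open>\<Phi>(p)\<close> after \<open>k\<close> steps
  is \<open>\<Sum>\<^bsub>j\<le>k\<^esub> min 2 m\<^sub>j - k\<close>, whereas \<open>p\<close> is a parking function iff \<open>\<Sum>\<^bsub>j\<le>k\<^esub> m\<^sub>j \<ge> k\<close> for
  all \<open>k\<close>. If all \<open>m\<^sub>j \<le> 2\<close>, the two conditions coincide. Conversely, since the \<open>m\<^sub>j\<close> sum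
  to \<open>n\<close>, a path ending at height 0 satisfies \<open>\<Sum> min 2 m\<^sub>j = \<Sum> m\<^sub>j\<close>, which forces
  \<open>m\<^sub>j \<le> 2\<close> for all \<open>j\<close>.
\<close>

text \<open>In a sorted list the entries \<open>\<le> c\<close> form an initial segment, so their
  number marks where it ends.\<close>

lemma sorted_nth_le_iff_less_length_filter:
  fixes xs :: "'a::linorder list"
  assumes "sorted xs" and "i < length xs"
  shows "xs ! i \<le> c \<longleftrightarrow> i < length (filter (\<lambda>x. x \<le> c) xs)"
  using assms
proof (induction xs arbitrary: i)
  case Nil
  then show ?case by simp
next
  case (Cons x xs)
  show ?case
  proof (cases "x \<le> c")
    case True
    then show ?thesis using Cons by (cases i) auto
  next
    case False
    then have gt: "\<forall>y\<in>set (x # xs). \<not> y \<le> c" using Cons.prems(1) by auto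
    then have "filter (\<lambda>x. x \<le> c) (x # xs) = []" by (simp only: filter_False)
    moreover have "\<not> (x # xs) ! i \<le> c" using gt Cons.prems(2) nth_mem by blast
    ultimately show ?thesis by simp
  qed
qed

lemma sort_nth_le_iff_length_filter:
  fixes p :: "nat list"
  assumes "length p = n"
  shows "(\<forall>i\<in>{1..n}. sort p ! (i - 1) \<le> i) \<longleftrightarrow> (\<forall>k\<le>n. k \<le> length (filter (\<lambda>x. x \<le> k) p))"
proof -
  have "sort p ! (i - 1) \<le> i \<longleftrightarrow> i \<le> length (filter (\<lambda>x. x \<le> i) p)" if "i \<in> {1..n}" for i
  proof -
    have "i - 1 < length (sort p)" using that assms by auto
    \<comment> \<open>Sorting preserves the filter's length, and \<open>i \<ge> 1\<close> turns the
      strict bound on \<open>i - 1\<close> into a weak one on \<open>i\<close>.\<close>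
    from sorted_nth_le_iff_less_length_filter[OF sorted_sort this, of i]
    show ?thesis using that by (simp add: filter_sort) linarith
  qed
  then have "(\<forall>i\<in>{1..n}. sort p ! (i - 1) \<le> i)
      \<longleftrightarrow> (\<forall>k\<in>{1..n}. k \<le> length (filter (\<lambda>x. x \<le> k) p))"
    by (rule ball_cong[OF refl])
  also have "\<dots> \<longleftrightarrow> (\<forall>k\<le>n. k \<le> length (filter (\<lambda>x. x \<le> k) p))"
    by (force simp: Suc_le_eq)
  finally show ?thesis .
qed

lemma multiplicity_of_eq_count_list: "multiplicity_of p j = count_list p j"
proof -
  have "{i \<in> {1..length p}. p ! (i - 1) = j} = Suc ` {i. i < length p \<and> j = p ! i}"
  proof (intro equalityI subsetI)
    fix i assume "i \<in> {i \<in> {1..length p}. p ! (i - 1) = j}"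
    then show "i \<in> Suc ` {i. i < length p \<and> j = p ! i}"
      by (intro image_eqI[of _ _ "i - 1"]) auto
  qed auto
  then show ?thesis
    by (simp add: multiplicity_of_def count_list_eq_length_filter length_filter_conv_card card_image)
qed

text \<open>Each car is counted once, at the spot it prefers. An entry 0 would pass the filter but
  be missed by the sum, which starts at 1.\<close>

lemma sum_multiplicity_of:
  assumes "0 \<notin> set p"
  shows "(\<Sum>j=1..k. multiplicity_of p j) = length (filter (\<lambda>x. x \<le> k) p)"
  using assms
proof (induction p)
  case Nil
  then show ?case by (simp add: multiplicity_of_eq_count_list)
next
  case (Cons x p)
  have "(\<Sum>j=1..k. count_list (x # p) j) = (\<Sum>j=1..k. (if x = j then 1 else 0) + count_list p j)"
    by (rule sum.cong) auto
  also have "\<dots> = (if x \<le> k then 1 else 0) + (\<Sum>j=1..k. count_list p j)"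
    using Cons.prems by (simp add: sum.distrib)
  finally show ?case
    using Cons by (simp add: multiplicity_of_eq_count_list)
qed

lemma fst_path_point: "fst (path_point w k) = int (length (take k w))"
proof -
  have "fst (sum_list (map step_vector u)) = int (length u)" for u
  proof (induction u)
    case (Cons s u)
    then show ?case by (cases s) auto
  qed simp
  then show ?thesis unfolding path_point_def .
qed

text \<open>\<open>U\<close>, \<open>H\<close> and \<open>D\<close> occur for multiplicity at least
  2, 1 and 0, so step \<open>j\<close> always rises by
  \<open>min 2 (multiplicity_of p j) - 1\<close>.\<close>

lemma snd_path_point_Phi:
  assumes "k \<le> n"
  shows "snd (path_point (Phi n p) k) = (\<Sum>j=1..k. int (min 2 (multiplicity_of p j))) - int k"
proof -
  have "snd (sum_list (map step_vector (map (Phi_step p) [1..<Suc k])))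
      = (\<Sum>j=1..k. int (min 2 (multiplicity_of p j))) - int k" for k
    by (induction k) (auto simp: Phi_step_def)
  moreover have "take k (Phi n p) = map (Phi_step p) [1..<Suc k]"
    using assms by (simp add: Phi_def take_map del: upt_Suc)
  ultimately show ?thesis by (simp add: path_point_def)
qed

text \<open>Truncation never increases a term, so a single \<open>f j > c\<close> already makes the
  left sum strictly smaller.\<close>

lemma sum_min_eq_iff:
  fixes f :: "'a \<Rightarrow> nat"
  assumes "finite A"
  shows "(\<Sum>j\<in>A. min c (f j)) = sum f A \<longleftrightarrow> (\<forall>j\<in>A. f j \<le> c)"
proof
  assume eq: "(\<Sum>j\<in>A. min c (f j)) = sum f A"
  show "\<forall>j\<in>A. f j \<le> c"
  proof (rule ccontr)
    assume "\<not> (\<forall>j\<in>A. f j \<le> c)"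
    then have "\<exists>j\<in>A. min c (f j) < f j" by (force simp: min_less_iff_disj)
    then have "(\<Sum>j\<in>A. min c (f j)) < sum f A"
      using assms by (intro sum_strict_mono_ex1) auto
    with eq show False by simp
  qed
qed (simp add: min_absorb2)

theorem theorem3p2:
  fixes n :: nat and p :: "nat list"
  assumes "p \<in> parking_preferences n"
  shows "motzkin_parking_function n p \<longleftrightarrow> motzkin_path n (Phi n p)"
proof -
  let ?m = "multiplicity_of p"
  have len: "length p = n" and p_le: "\<forall>x\<in>set p. x \<le> n" and "0 \<notin> set p"
    using assms by (auto simp: parking_preferences_def)
  note sum_m = sum_multiplicity_of[OF \<open>0 \<notin> set p\<close>]
  have total: "(\<Sum>j=1..n. ?m j) = n"
    using p_le len by (simp only: sum_m filter_True)
  have parking: "parking_function n p \<longleftrightarrow> (\<forall>k\<le>n. k \<le> (\<Sum>j=1..k. ?m j))"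
    using assms by (simp only: parking_function_def sort_nth_le_iff_length_filter[OF len] sum_m simp_thms)
  have height: "snd (path_point (Phi n p) k) = int (\<Sum>j=1..k. min 2 (?m j)) - int k" if "k \<le> n" for k
    using snd_path_point_Phi[OF that] by simp
  have "length (Phi n p) = n" by (simp add: Phi_def)
  \<comment> \<open>The first coordinate of the endpoint is automatically \<open>n\<close>, so only
    heights matter. Keeping each sum under one \<open>int\<close> lets the conditions descend to
    \<open>nat\<close>.\<close>
  then have "motzkin_path n (Phi n p) \<longleftrightarrow>
      (\<Sum>j=1..n. min 2 (?m j)) = n \<and> (\<forall>k\<le>n. k \<le> (\<Sum>j=1..k. min 2 (?m j)))"
    by (auto simp: motzkin_path_def prod_eq_iff fst_path_point height simp del: of_nat_sum)
  also have "\<dots> \<longleftrightarrow> (\<forall>j\<in>{1..n}. ?m j \<le> 2) \<and> (\<forall>k\<le>n. k \<le> (\<Sum>j=1..k. min 2 (?m j)))"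
    using sum_min_eq_iff[of "{1..n}" 2 ?m] total by simp
  also have "\<dots> \<longleftrightarrow> (\<forall>j\<in>{1..n}. ?m j \<le> 2) \<and> (\<forall>k\<le>n. k \<le> (\<Sum>j=1..k. ?m j))"
  \<comment> \<open>The congruence rule makes the bound 2 available, under which truncation changes
    no term.\<close>
  proof (rule conj_cong[OF refl])
    assume "\<forall>j\<in>{1..n}. ?m j \<le> 2"
    then have "(\<Sum>j=1..k. min 2 (?m j)) = (\<Sum>j=1..k. ?m j)" if "k \<le> n" for k
      using that by (intro sum.cong) auto
    then show "(\<forall>k\<le>n. k \<le> (\<Sum>j=1..k. min 2 (?m j))) \<longleftrightarrow> (\<forall>k\<le>n. k \<le> (\<Sum>j=1..k. ?m j))"
      by simp
  qed
  finally show ?thesis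
    using parking by (auto simp: motzkin_parking_function_def)
qed

end
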